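(* Let $F$ be a clause set. If $F$ is satisfiable, then the reasoning algorithm with inference rules $\mathrm{A1}^+$, $\mathrm{A2}^+$, and A3, started from $\mathcal{S}_0=\{F\}$, yields a complete and clash-free family of clause sets (i.e. some sequence of rule applications from $\mathcal{S}_0$ ends in a complete and clash-free family).
   Context: $\mathcal{ALC}$ interpretations $\mathcal{I}=(\Delta^\mathcal{I},\cdot^\mathcal{I})$ with the standard semantics of $\lnot,\sqcap,\sqcup,\forall R.,\exists R.$. Conjunctive normal forms are defined by mutual induction: a concept literal is $A$, $\lnot A$ ($A$ a concept name), $\exists R.F$ or $\forall R.F$ ($R$ a role name, $F$ a conjunctive normal form); a clause is a finite disjunction of concept literals, represented as a set of literals; a conjunctive normal form is a finite conjunction of clauses, represented as a clause set. A clause set denotes the conjunction of its clauses, each clause the disjunction of its literals; $F$ is satisfiable if $F^\mathcal{I}\neq\emptyset$ for some $\mathcal{I}$. The complementary literal $\overline{L}$ is: $\overline{A}=\lnot A$, $\overline{\lnot A}=A$, $\overline{\exists R.F}=\forall R.\mathrm{CNF}(\lnot F)$, $\overline{\forall R.F}=\exists R.\mathrm{CNF}(\lnot F)$, with $\mathrm{CNF}(C)$ the equivalent conjunctive normal form of $C$ (push negations inward, distribute $\sqcup$ over $\sqcap$, flatten). A derivation works on families of clause sets $\mathcal{S}_i$, starting with $\mathcal{S}_0=\{F\}$; $\mathcal{S}_{i+1}$ is obtained from $\mathcal{S}_i$ by applying one of the following rules to a clause set $F\in\mathcal{S}_i$: ($\mathrm{A1}^+$) if $L\in CL$ for a clause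 $CL\in F$ (nondeterministic choice of $L$): replace every clause $CL'\in F$ with $L\in CL'$ by $\{L\}$, and every clause $CL'\in F$ with $\overline{L}\in CL'$ by $CL'\setminus\{\overline{L}\}$. ($\mathrm{A2}^+$) if all clauses of $F$ are unit clauses and $\forall R.F_1\in CL$ for some $CL\in F$: remove from $F$ all clauses containing $\forall R.F_1$, and replace every literal $\exists R.F_2$ occurring in clauses of $F$ by $\exists R.(F_1\cup F_2)$. (A3) if all clauses of $F$ are unit clauses of the form $\{A\}$, $\{\lnot A\}$ or $\{\exists R.F'\}$: for some $\{\exists R.F_1\}\in F$, replace $F$ by $F\setminus\{\{\exists R.F_1\}\}$ and add $F_1$ to the family ($F$ is the parent of $F_1$ with respect to $R$). A family is complete if no rule is applicable to it. It is clash-free if no clause set in it contains the empty clause or contains both $\{L\}$ and $\{\overline{L}\}$ for some literal $L$.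
   Formalization: Rule A1+ counts as applicable only if it changes the clause set (and "complete" is meant accordingly); read literally, A1+ could be re-applied forever without effect, e.g. to F={{A}}, so that no complete family would be reachable. *)

theory Defs
  imports Main "HOL-Library.FSet"
begin

datatype ('c, 'r) literal =
    Pos 'c
  | Neg 'c
  | Ex 'r "('c, 'r) literal fset fset"
  | All 'r "('c, 'r) literal fset fset"

type_synonym ('c, 'r) clause = "('c, 'r) literal fset"
type_synonym ('c, 'r) clause_set = "('c, 'r) clause fset"

record ('c, 'r, 'd) interp =
  domain :: "'d set"
  conc :: "'c \<Rightarrow> 'd set"
  role :: "'r \<Rightarrow> ('d \<times> 'd) set"

definition is_interp :: "('c, 'r, 'd) interp \<Rightarrow> bool" where
  "is_interp I \<longleftrightarrow> domain I \<noteq> {} \<and> (\<forall>A. conc I A \<subseteq> domain I) \<and> (\<forall>R. role I R \<subseteq> domain I \<times> domain I)"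

lemma size_in_clause: "L |\<in>| CL \<Longrightarrow> size L < size_fset size CL"
  using sum.remove[of "fset CL" L "Suc \<circ> size"] by (simp add: size_fset_simps)

lemma size_in_clause_set: "CL |\<in>| F \<Longrightarrow> size_fset size CL < size_fset (size_fset size) F"
  using sum.remove[of "fset F" CL "Suc \<circ> size_fset size"] by (simp add: size_fset_simps)

lemma size_nested_literal:
  assumes "CL |\<in>| F" "L |\<in>| CL"
  shows "size L < size (Ex R F)" "size L < size (All R F)"
  using size_in_clause_set[OF assms(1)] size_in_clause[OF assms(2)] by simp_all

function literal_ext :: "('c, 'r, 'd) interp \<Rightarrow> ('c, 'r) literal \<Rightarrow> 'd set"
  and clause_ext :: "('c, 'r, 'd) interp \<Rightarrow> ('c, 'r) clause \<Rightarrow> 'd set"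
  and clause_set_ext :: "('c, 'r, 'd) interp \<Rightarrow> ('c, 'r) clause_set \<Rightarrow> 'd set"
where
  "literal_ext I (Pos A) = conc I A"
| "literal_ext I (Neg A) = domain I - conc I A"
| "literal_ext I (Ex R F) =
     {x \<in> domain I. \<exists>y. (x, y) \<in> role I R \<and> y \<in> clause_set_ext I F}"
| "literal_ext I (All R F) =
     {x \<in> domain I. \<forall>y. (x, y) \<in> role I R \<longrightarrow> y \<in> clause_set_ext I F}"
| "clause_ext I CL = {x \<in> domain I. \<exists>L \<in> fset CL. x \<in> literal_ext I L}"
| "clause_set_ext I F = {x \<in> domain I. \<forall>CL \<in> fset F. x \<in> clause_ext I CL}"
  by pat_completeness auto
termination
  by (relation "measure (case_sum (\<lambda>(I, L). size L)
        (case_sum (\<lambda>(I, CL). size_fset size CL) (\<lambda>(I, F). size_fset (size_fset size) F)))")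
     (simp_all add: size_in_clause size_in_clause_set del: size_fset_simps)

declare clause_ext.simps [simp del] clause_set_ext.simps [simp del]

text \<open>The type of the domain elements is a parameter, since HOL cannot quantify over types
  inside a formula.\<close>

definition satisfiable :: "'d itself \<Rightarrow> ('c, 'r) clause_set \<Rightarrow> bool" where
  "satisfiable _ F \<longleftrightarrow> (\<exists>I :: ('c, 'r, 'd) interp. is_interp I \<and> clause_set_ext I F \<noteq> {})"

text \<open>All sets that arise by picking one literal from every clause of \<open>F\<close>.\<close>

definition choices :: "'a fset fset \<Rightarrow> 'a fset fset" where
  "choices F =
     ffilter (\<lambda>T. \<exists>f. (\<forall>CL \<in> fset F. f CL |\<in>| CL) \<and> T = f |`| F) (fPow (ffUnion F))"

lemma choices_iff:
  "T |\<in>| choices F \<longleftrightarrow> (\<exists>f. (\<forall>CL \<in> fset F. f CL |\<in>| CL) \<and> T = f |`| F)"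
proof -
  have "f |`| F |\<subseteq>| ffUnion F" if f: "\<forall>CL \<in> fset F. f CL |\<in>| CL" for f
  proof (rule fsubsetI)
    fix x assume "x |\<in>| f |`| F"
    then obtain CL where "x = f CL" "CL |\<in>| F" by (rule fimageE)
    with f show "x |\<in>| ffUnion F" by (auto simp: ffUnion.rep_eq)
  qed
  then show ?thesis
    unfolding choices_def ffmember_filter fPow_iff by metis
qed

lemma size_in_choices:
  assumes "T |\<in>| choices F" "L |\<in>| T"
  shows "size L < size_fset (size_fset size) F"
proof -
  from assms(1) obtain f where f: "\<forall>CL \<in> fset F. f CL |\<in>| CL" "T = f |`| F"
    unfolding choices_iff by blast
  with assms(2) obtain CL where "CL |\<in>| F" "L = f CL"
    by (metis fimageE)
  with f(1) have "CL |\<in>| F" "L |\<in>| CL"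
    by simp_all
  then show ?thesis
    using less_trans[OF size_in_clause size_in_clause_set] by blast
qed

text \<open>\<open>cnf_neg F\<close> is the conjunctive normal form of the negation of \<open>F\<close>. Pushing the negation
  inward gives the disjunction, over the clauses of \<open>F\<close>, of the conjunctions of the complements of
  their literals. Distributing disjunction over conjunction turns this into one clause of
  complements for each way of picking a literal from every clause of \<open>F\<close>.\<close>

function compl_literal :: "('c, 'r) literal \<Rightarrow> ('c, 'r) literal"
  and cnf_neg :: "('c, 'r) clause_set \<Rightarrow> ('c, 'r) clause_set"
where
  "compl_literal (Pos A) = Neg A"
| "compl_literal (Neg A) = Pos A"
| "compl_literal (Ex R F) = All R (cnf_neg F)"
| "compl_literal (All R F) = Ex R (cnf_neg F)"
| "cnf_neg F = (\<lambda>T. compl_literal |`| T) |`| choices F"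
  by pat_completeness auto
termination
  by (relation "measure (case_sum size (size_fset (size_fset size)))")
     (simp_all add: size_in_choices del: size_fset_simps)

declare cnf_neg.simps [simp del]

lemma cnf_neg_ext_aux:
  assumes "x \<in> domain I"
    and compl: "\<And>CL L. CL |\<in>| F \<Longrightarrow> L |\<in>| CL \<Longrightarrow> literal_ext I (compl_literal L) = domain I - literal_ext I L"
  shows "x \<in> clause_set_ext I (cnf_neg F) \<longleftrightarrow> x \<notin> clause_set_ext I F"
proof
  assume l: "x \<in> clause_set_ext I (cnf_neg F)"
  show "x \<notin> clause_set_ext I F"
  proof
    assume "x \<in> clause_set_ext I F"
    then have "\<forall>CL \<in> fset F. \<exists>L. L |\<in>| CL \<and> x \<in> literal_ext I L"
      by (auto simp: clause_set_ext.simps clause_ext.simps)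
    then obtain f where f: "\<forall>CL \<in> fset F. f CL |\<in>| CL \<and> x \<in> literal_ext I (f CL)"
      by metis
    then have "compl_literal |`| (f |`| F) |\<in>| cnf_neg F"
      unfolding cnf_neg.simps by (intro fimageI) (auto simp: choices_iff)
    with l have "x \<in> clause_ext I (compl_literal |`| (f |`| F))"
      by (auto simp: clause_set_ext.simps)
    with f compl show False
      by (auto simp: clause_ext.simps)
  qed
next
  assume "x \<notin> clause_set_ext I F"
  then obtain CL where "CL |\<in>| F" "\<forall>L \<in> fset CL. x \<notin> literal_ext I L"
    using assms(1) by (auto simp: clause_set_ext.simps clause_ext.simps)
  then have "x \<in> clause_ext I (compl_literal |`| T)" if "T |\<in>| choices F" for T
    using that assms(1) compl unfolding choices_iff
    by (auto simp: clause_ext.simps intro!: bexI[of _ CL])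
  then show "x \<in> clause_set_ext I (cnf_neg F)"
    using assms(1) by (auto simp: clause_set_ext.simps cnf_neg.simps)
qed

lemma compl_ext:
  assumes "is_interp I"
  shows "literal_ext I (compl_literal L) = domain I - literal_ext I L"
proof (induction L rule: measure_induct_rule[of size])
  case (less L)
  have IH: "x \<in> clause_set_ext I (cnf_neg F) \<longleftrightarrow> x \<notin> clause_set_ext I F"
    if "L = Ex R F \<or> L = All R F" "x \<in> domain I" for x R F
  proof (rule cnf_neg_ext_aux[OF that(2)])
    fix CL L'
    assume "CL |\<in>| F" "L' |\<in>| CL"
    then have "size L' < size L"
      using that(1) size_nested_literal by metis
    then show "literal_ext I (compl_literal L') = domain I - literal_ext I L'"
      by (rule less)
  qed
  have dom: "y \<in> domain I" if "(x, y) \<in> role I R" for x y R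
    using that assms by (auto simp: is_interp_def)
  show ?case
  proof (cases L)
    case (Pos A)
    then show ?thesis by simp
  next
    case (Neg A)
    then show ?thesis using assms by (auto simp: is_interp_def)
  next
    case (Ex R F)
    show ?thesis
      unfolding Ex compl_literal.simps literal_ext.simps
      using IH[OF disjI1[OF Ex]] dom by (auto simp del: literal_ext.simps)
  next
    case (All R F)
    show ?thesis
      unfolding All compl_literal.simps literal_ext.simps
      using IH[OF disjI2[OF All]] dom by (auto simp del: literal_ext.simps)
  qed
qed

theorem cnf_neg_ext:
  assumes "is_interp I"
  shows "clause_set_ext I (cnf_neg F) = domain I - clause_set_ext I F"
proof (rule set_eqI)
  fix x
  show "x \<in> clause_set_ext I (cnf_neg F) \<longleftrightarrow> x \<in> domain I - clause_set_ext I F"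
  proof (cases "x \<in> domain I")
    case True
    then show ?thesis
      using cnf_neg_ext_aux[OF True compl_ext[OF assms]] by simp
  next
    case False
    then show ?thesis
      by (simp add: clause_set_ext.simps)
  qed
qed

definition unit_clause :: "('c, 'r) clause \<Rightarrow> bool" where
  "unit_clause CL \<longleftrightarrow> (\<exists>L. CL = {|L|})"

definition A1_result :: "('c, 'r) literal \<Rightarrow> ('c, 'r) clause_set \<Rightarrow> ('c, 'r) clause_set" where
  "A1_result L F = (\<lambda>CL. if L |\<in>| CL then {|L|} else CL |-| {|compl_literal L|}) |`| F"

fun strengthen_Ex :: "'r \<Rightarrow> ('c, 'r) clause_set \<Rightarrow> ('c, 'r) literal \<Rightarrow> ('c, 'r) literal" where
  "strengthen_Ex R F1 (Ex R' F2) = (if R' = R then Ex R (F1 |\<union>| F2) else Ex R' F2)"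
| "strengthen_Ex R F1 L = L"

definition A2_result :: "'r \<Rightarrow> ('c, 'r) clause_set \<Rightarrow> ('c, 'r) clause_set \<Rightarrow> ('c, 'r) clause_set" where
  "A2_result R F1 F =
     (\<lambda>CL. strengthen_Ex R F1 |`| CL) |`| ffilter (\<lambda>CL. All R F1 |\<notin>| CL) F"

text \<open>A rule is applicable only if it changes the clause set. For \<open>A2\<close> and \<open>A3\<close> this is automatic;
  without the side condition \<open>A1_result L F \<noteq> F\<close>, rule \<open>A1\<close> could be applied forever to any
  nonempty clause, for instance to a unit clause \<open>{|L|}\<close>, with no effect.\<close>

inductive rule_step :: "('c, 'r) clause_set set \<Rightarrow> ('c, 'r) clause_set set \<Rightarrow> bool" where
  A1: "rule_step S (S - {F} \<union> {A1_result L F})"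
    if "F \<in> S" "CL |\<in>| F" "L |\<in>| CL" "A1_result L F \<noteq> F"
| A2: "rule_step S (S - {F} \<union> {A2_result R F1 F})"
    if "F \<in> S" "\<forall>CL \<in> fset F. unit_clause CL" "CL |\<in>| F" "All R F1 |\<in>| CL"
| A3: "rule_step S (S - {F} \<union> {F |-| {|{|Ex R F1|}|}, F1})"
    if "F \<in> S"
      "\<forall>CL \<in> fset F. (\<exists>A. CL = {|Pos A|}) \<or> (\<exists>A. CL = {|Neg A|}) \<or> (\<exists>R' F'. CL = {|Ex R' F'|})"
      "{|Ex R F1|} |\<in>| F"

definition family_complete :: "('c, 'r) clause_set set \<Rightarrow> bool" where
  "family_complete S \<longleftrightarrow> (\<nexists>S'. rule_step S S')"

definition family_clash_free :: "('c, 'r) clause_set set \<Rightarrow> bool" where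
  "family_clash_free S \<longleftrightarrow>
     (\<forall>F \<in> S. {||} |\<notin>| F \<and> (\<nexists>L. {|L|} |\<in>| F \<and> {|compl_literal L|} |\<in>| F))"

end

theory Submission
  imports Defs "HOL-Library.Multiset"
begin

text \<open>Every rule application replaces a clause set by clause sets that are smaller in the
  lexicographic order of role depth and number of literal occurrences, so by the multiset extension
  of this order every derivation from a finite family terminates. Role depth has to be a maximum,
  not a sum, because \<open>A2\<close> copies \<open>F1\<close> into every matching existential literal.

  Fix an interpretation \<open>I\<close> satisfying the initial clause set. If every clause set of a family is
  satisfied somewhere in \<open>I\<close> and a rule is applicable, then some rule application preserves this:
  \<open>A2\<close> and \<open>A3\<close> always do, and \<open>A1\<close> does if it picks a literal that is true at an element
  satisfying the clause set. If a false literal was picked, then its clause is not a unit clause, so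
  \<open>A1\<close> with a true literal of that clause changes the clause set as well. A maximal derivation
  through such families ends in a complete family, and a satisfied clause set contains no clash.\<close>

lemma SUP_nat_le_iff:
  fixes f :: "'a \<Rightarrow> nat"
  assumes "finite A"
  shows "(SUP a \<in> A. f a) \<le> n \<longleftrightarrow> (\<forall>a \<in> A. f a \<le> n)"
  using assms by (cases "A = {}") (simp_all add: cSUP_le_iff)

lemma multp_mset_set_replace:
  assumes "finite S" "a \<in> S" "finite N" "\<forall>b \<in> N. R b a"
  shows "multp R (mset_set (S - {a} \<union> N)) (mset_set S)"
proof -
  let ?rest = "S - {a}"
  have "mset_set (?rest \<union> N) = mset_set (?rest \<union> (N - ?rest))"
    by (rule arg_cong[of _ _ mset_set]) blast
  also have "\<dots> = mset_set ?rest + mset_set (N - ?rest)"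
    using assms(1,3) by (intro mset_set_Union) auto
  finally have "mset_set (?rest \<union> N) = mset_set ?rest + mset_set (N - ?rest)" .
  moreover have "mset_set S = mset_set ?rest + {#a#}"
    using assms(1,2) by (simp add: mset_set.remove)
  moreover have "multp R (mset_set ?rest + mset_set (N - ?rest)) (mset_set ?rest + {#a#})"
    using assms(3,4) by (intro one_step_implies_multp) auto
  ultimately show ?thesis by simp
qed

function literal_depth :: "('c, 'r) literal \<Rightarrow> nat"
  and clause_set_depth :: "('c, 'r) clause_set \<Rightarrow> nat"
where
  "literal_depth (Pos A) = 0"
| "literal_depth (Neg A) = 0"
| "literal_depth (Ex R F) = Suc (clause_set_depth F)"
| "literal_depth (All R F) = Suc (clause_set_depth F)"
| "clause_set_depth F = (SUP CL \<in> fset F. SUP L \<in> fset CL. literal_depth L)"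
  by pat_completeness auto
termination
  by (relation "measure (case_sum size (size_fset (size_fset size)))")
    (auto intro: less_trans[OF size_in_clause size_in_clause_set] simp del: size_fset_simps)

declare clause_set_depth.simps [simp del]

lemma clause_set_depth_le_iff:
  "clause_set_depth F \<le> n \<longleftrightarrow> (\<forall>CL \<in> fset F. \<forall>L \<in> fset CL. literal_depth L \<le> n)"
  by (simp add: clause_set_depth.simps SUP_nat_le_iff)

lemma literal_depth_le_clause_set_depth:
  "CL |\<in>| F \<Longrightarrow> L |\<in>| CL \<Longrightarrow> literal_depth L \<le> clause_set_depth F"
  using clause_set_depth_le_iff by blast

lemma clause_set_depth_funion:
  "clause_set_depth (F |\<union>| G) = max (clause_set_depth F) (clause_set_depth G)"
proof -
  have "clause_set_depth (F |\<union>| G) \<le> n \<longleftrightarrow> max (clause_set_depth F) (clause_set_depth G) \<le> n" for n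
    by (auto simp: clause_set_depth_le_iff)
  then show ?thesis
    by (metis order_antisym order_refl)
qed

lemma literal_depth_strengthen_Ex_le:
  "literal_depth (strengthen_Ex R F L) \<le> max (literal_depth (All R F)) (literal_depth L)"
  by (cases "(R, F, L)" rule: strengthen_Ex.cases) (auto simp: clause_set_depth_funion)

definition occurrences :: "('c, 'r) clause_set \<Rightarrow> nat" where
  "occurrences F = (\<Sum>CL \<in> fset F. fcard CL)"

lemma occurrences_fimage_le: "occurrences (f |`| F) \<le> (\<Sum>CL \<in> fset F. fcard (f CL))"
  unfolding occurrences_def using sum_image_le[of "fset F" fcard f] by simp

lemma occurrences_fimage_fimage_le:
  "occurrences ((\<lambda>CL. h |`| CL) |`| F) \<le> occurrences F"
proof -
  have "(\<Sum>CL \<in> fset F. fcard (h |`| CL)) \<le> (\<Sum>CL \<in> fset F. fcard CL)"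
    by (intro sum_mono) (simp add: fcard.rep_eq card_image_le)
  with occurrences_fimage_le show ?thesis
    unfolding occurrences_def by (rule order_trans)
qed

lemma occurrences_fimage_less:
  assumes shrink: "\<And>CL. CL |\<in>| F \<Longrightarrow> f CL |\<subseteq>| CL" and "f |`| F \<noteq> F"
  shows "occurrences (f |`| F) < occurrences F"
proof -
  have fcard_le: "fcard (f CL) \<le> fcard CL" if "CL |\<in>| F" for CL
    using shrink[OF that] by (rule fcard_mono)
  have "f |`| F = id |`| F" if "\<forall>CL \<in> fset F. f CL = CL"
    using that by (intro fset.map_cong0) simp
  with assms(2) obtain CL where changed: "CL |\<in>| F" "f CL \<noteq> CL" by auto
  then have "fcard (f CL) < fcard CL"
    using shrink by (intro pfsubset_fcard_mono) auto
  with changed have "(\<Sum>CL \<in> fset F. fcard (f CL)) < (\<Sum>CL \<in> fset F. fcard CL)"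
    by (intro sum_strict_mono_ex1) (auto intro: fcard_le)
  with occurrences_fimage_le show ?thesis
    unfolding occurrences_def by (rule order.strict_trans1)
qed

lemma occurrences_fsubset_less:
  assumes "G |\<subseteq>| F" "CL |\<in>| F" "CL |\<notin>| G" "CL \<noteq> {||}"
  shows "occurrences G < occurrences F"
proof -
  have "0 < fcard CL"
    using assms(4) by (auto simp: fcard.rep_eq card_gt_0_iff)
  with assms(1-3) show ?thesis
    unfolding occurrences_def
    by (intro sum_strict_mono2[where b = CL]) (auto simp: less_eq_fset.rep_eq)
qed

definition clause_set_less :: "('c, 'r) clause_set \<Rightarrow> ('c, 'r) clause_set \<Rightarrow> bool"
    (infix \<open>\<prec>\<close> 50) where
  "G \<prec> F \<longleftrightarrow> (G, F) \<in> measures [clause_set_depth, occurrences]"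

lemma wfp_clause_set_less: "wfp (\<prec>)"
  unfolding clause_set_less_def[abs_def] wfp_on_wf_on_eq by (rule wf_measures)

lemma clause_set_lessI_depth: "clause_set_depth G < clause_set_depth F \<Longrightarrow> G \<prec> F"
  by (simp add: clause_set_less_def)

lemma clause_set_lessI_occurrences:
  "clause_set_depth G \<le> clause_set_depth F \<Longrightarrow> occurrences G < occurrences F \<Longrightarrow> G \<prec> F"
  by (auto simp: clause_set_less_def)

lemma A1_result_less:
  assumes "A1_result L F \<noteq> F"
  shows "A1_result L F \<prec> F"
proof (rule clause_set_lessI_occurrences)
  show "clause_set_depth (A1_result L F) \<le> clause_set_depth F"
    unfolding clause_set_depth_le_iff A1_result_def
    by (auto intro: literal_depth_le_clause_set_depth)
  show "occurrences (A1_result L F) < occurrences F"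
    using assms unfolding A1_result_def by (intro occurrences_fimage_less) auto
qed

lemma A2_result_less:
  assumes "CL |\<in>| F" "All R F1 |\<in>| CL"
  shows "A2_result R F1 F \<prec> F"
proof (rule clause_set_lessI_occurrences)
  have "literal_depth (strengthen_Ex R F1 L) \<le> clause_set_depth F"
    if "C |\<in>| F" "L |\<in>| C" for C L
    using literal_depth_strengthen_Ex_le
      literal_depth_le_clause_set_depth[OF assms] literal_depth_le_clause_set_depth[OF that]
    by (rule order_trans[OF _ max.boundedI])
  then show "clause_set_depth (A2_result R F1 F) \<le> clause_set_depth F"
    unfolding clause_set_depth_le_iff A2_result_def by auto
next
  have "occurrences (A2_result R F1 F) \<le> occurrences (ffilter (\<lambda>CL. All R F1 |\<notin>| CL) F)"
    unfolding A2_result_def by (rule occurrences_fimage_fimage_le)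
  also have "\<dots> < occurrences F"
    using assms by (intro occurrences_fsubset_less[of _ _ CL]) auto
  finally show "occurrences (A2_result R F1 F) < occurrences F" .
qed

lemma fminus_clause_less:
  assumes "CL |\<in>| F" "CL \<noteq> {||}"
  shows "F |-| {|CL|} \<prec> F"
proof (rule clause_set_lessI_occurrences)
  show "clause_set_depth (F |-| {|CL|}) \<le> clause_set_depth F"
    unfolding clause_set_depth_le_iff by (auto intro: literal_depth_le_clause_set_depth)
  show "occurrences (F |-| {|CL|}) < occurrences F"
    using assms by (intro occurrences_fsubset_less[of _ _ CL]) auto
qed

lemma Ex_successor_less:
  assumes "CL |\<in>| F" "Ex R G |\<in>| CL"
  shows "G \<prec> F"
  using literal_depth_le_clause_set_depth[OF assms] by (intro clause_set_lessI_depth) simp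

lemma rule_step_replaces_by_less:
  assumes "rule_step S S'"
  obtains F N where "F \<in> S" "finite N" "S' = S - {F} \<union> N" "\<forall>G \<in> N. G \<prec> F"
  using assms
proof cases
  case (A1 F CL L)
  then show ?thesis
    using A1_result_less[OF A1(5)] by (intro that[of F "{A1_result L F}"]) auto
next
  case (A2 F CL R F1)
  then show ?thesis
    using A2_result_less[OF A2(4,5)] by (intro that[of F "{A2_result R F1 F}"]) auto
next
  case (A3 F R F1)
  then show ?thesis
    using fminus_clause_less[OF A3(4)] Ex_successor_less[OF A3(4)]
    by (intro that[of F "{F |-| {|{|Ex R F1|}|}, F1}"]) auto
qed

lemma rule_step_finite: "rule_step S S' \<Longrightarrow> finite S \<Longrightarrow> finite S'"
  by (erule rule_step.cases) auto

theorem wfp_on_finite_rule_step: "wfp_on {S. finite S} rule_step\<inverse>\<inverse>"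
proof (rule wfp_on_mono_stronger[OF wfp_multp[OF wfp_clause_set_less]])
  fix S' S :: "('c, 'r) clause_set set"
  assume "S \<in> {S. finite S}" "rule_step\<inverse>\<inverse> S' S"
  then have "finite S" "rule_step S S'" by simp_all
  from \<open>rule_step S S'\<close> show "multp (\<prec>) (mset_set S') (mset_set S)"
  proof (rule rule_step_replaces_by_less)
    fix F N
    assume "F \<in> S" "finite N" "S' = S - {F} \<union> N" "\<forall>G \<in> N. G \<prec> F"
    with \<open>finite S\<close> show ?thesis
      by (simp add: multp_mset_set_replace)
  qed
qed simp

lemma in_clause_set_ext_iff:
  "x \<in> clause_set_ext I F \<longleftrightarrow>
    x \<in> domain I \<and> (\<forall>CL \<in> fset F. \<exists>L \<in> fset CL. x \<in> literal_ext I L)"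
  by (auto simp: clause_set_ext.simps clause_ext.simps)

lemma in_clause_set_ext_unit:
  "x \<in> clause_set_ext I F \<Longrightarrow> {|L|} |\<in>| F \<Longrightarrow> x \<in> literal_ext I L"
  by (auto simp: in_clause_set_ext_iff)

lemma clause_set_ext_antimono: "G |\<subseteq>| F \<Longrightarrow> clause_set_ext I F \<subseteq> clause_set_ext I G"
  unfolding in_clause_set_ext_iff subset_iff by (meson fsubsetD)

lemma not_in_literal_ext_compl:
  "is_interp I \<Longrightarrow> x \<in> literal_ext I L \<Longrightarrow> x \<notin> literal_ext I (compl_literal L)"
  by (simp add: compl_ext)

lemma A1_result_ext:
  assumes "is_interp I"
  shows "clause_set_ext I F \<inter> literal_ext I L \<subseteq> clause_set_ext I (A1_result L F)"
  using not_in_literal_ext_compl[OF assms]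
  by (fastforce simp: in_clause_set_ext_iff A1_result_def)

lemma A1_result_neq:
  assumes "CL |\<in>| F" "L |\<in>| CL" "CL \<noteq> {|L|}"
  shows "A1_result L F \<noteq> F"
proof -
  have "CL |\<notin>| A1_result L F"
    using assms(2,3) by (auto simp: A1_result_def split: if_splits)
  with assms(1) show ?thesis by auto
qed

lemma A1_result_satisfied_choice:
  assumes interp: "is_interp I" and "clause_set_ext I F \<noteq> {}"
    and CL_in: "CL |\<in>| F" and L_changes: "L |\<in>| CL" "A1_result L F \<noteq> F"
  obtains K where "K |\<in>| CL" "A1_result K F \<noteq> F" "clause_set_ext I (A1_result K F) \<noteq> {}"
proof -
  from assms(2) obtain x where x_in: "x \<in> clause_set_ext I F" by blast
  have "\<exists>K. K |\<in>| CL \<and> A1_result K F \<noteq> F \<and> x \<in> literal_ext I K"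
  proof (cases "x \<in> literal_ext I L")
    case True
    with L_changes show ?thesis by blast
  next
    case False
    obtain K where true_K: "K |\<in>| CL" "x \<in> literal_ext I K"
      using x_in CL_in by (auto simp: in_clause_set_ext_iff)
    with False L_changes(1) have "CL \<noteq> {|K|}" by auto
    with true_K CL_in show ?thesis
      using A1_result_neq by blast
  qed
  with x_in show ?thesis
    using A1_result_ext[OF interp] that by blast
qed

lemma strengthen_Ex_ext:
  assumes "x \<in> literal_ext I (All R F)" "x \<in> literal_ext I L"
  shows "x \<in> literal_ext I (strengthen_Ex R F L)"
  using assms
  by (cases "(R, F, L)" rule: strengthen_Ex.cases) (auto simp: clause_set_ext.simps)

lemma A2_result_ext:
  assumes "{|All R F1|} |\<in>| F"
  shows "clause_set_ext I F \<subseteq> clause_set_ext I (A2_result R F1 F)"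
proof
  fix x
  assume x_in: "x \<in> clause_set_ext I F"
  show "x \<in> clause_set_ext I (A2_result R F1 F)"
    using x_in strengthen_Ex_ext[OF in_clause_set_ext_unit[OF x_in assms]]
    by (fastforce simp: in_clause_set_ext_iff A2_result_def simp del: literal_ext.simps)
qed

lemma Ex_successor_satisfied:
  assumes "clause_set_ext I F \<noteq> {}" "{|Ex R G|} |\<in>| F"
  shows "clause_set_ext I G \<noteq> {}"
  using assms in_clause_set_ext_unit by fastforce

definition family_satisfied :: "('c, 'r, 'd) interp \<Rightarrow> ('c, 'r) clause_set set \<Rightarrow> bool" where
  "family_satisfied I S \<longleftrightarrow> (\<forall>F \<in> S. clause_set_ext I F \<noteq> {})"

lemma family_satisfied_replace:
  assumes "family_satisfied I S" "\<forall>G \<in> N. clause_set_ext I G \<noteq> {}"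
  shows "family_satisfied I (S - {F} \<union> N)"
  using assms by (auto simp: family_satisfied_def)

lemma satisfied_rule_step_exists:
  assumes interp: "is_interp I" and satisfied: "family_satisfied I S" and step: "rule_step S S'"
  shows "\<exists>S''. rule_step S S'' \<and> family_satisfied I S''"
proof -
  have satisfiable_member: "clause_set_ext I F \<noteq> {}" if "F \<in> S" for F
    using satisfied that by (simp add: family_satisfied_def)
  from step show ?thesis
  proof cases
    case (A1 F CL L)
    obtain K where choice: "K |\<in>| CL" "A1_result K F \<noteq> F" "clause_set_ext I (A1_result K F) \<noteq> {}"
      using A1_result_satisfied_choice[OF interp satisfiable_member[OF A1(2)] A1(3-5)] by blast
    have "rule_step S (S - {F} \<union> {A1_result K F})"
      using A1(2,3) choice(1,2) by (rule rule_step.A1)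
    moreover have "family_satisfied I (S - {F} \<union> {A1_result K F})"
      using choice(3) by (intro family_satisfied_replace[OF satisfied]) simp
    ultimately show ?thesis by blast
  next
    case (A2 F CL R F1)
    have "{|All R F1|} |\<in>| F"
      using A2(3-5) by (auto simp: unit_clause_def)
    then have "clause_set_ext I (A2_result R F1 F) \<noteq> {}"
      using A2_result_ext[of R F1 F I] satisfiable_member[OF A2(2)] by auto
    then have "family_satisfied I S'"
      unfolding A2(1) by (intro family_satisfied_replace[OF satisfied]) simp
    with step show ?thesis by blast
  next
    case (A3 F R F1)
    have "clause_set_ext I (F |-| {|{|Ex R F1|}|}) \<noteq> {}"
      using clause_set_ext_antimono[of "F |-| {|{|Ex R F1|}|}" F I] satisfiable_member[OF A3(2)]
      by auto
    moreover have "clause_set_ext I F1 \<noteq> {}"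
      using satisfiable_member[OF A3(2)] A3(4) by (rule Ex_successor_satisfied)
    ultimately have "family_satisfied I S'"
      unfolding A3(1) by (intro family_satisfied_replace[OF satisfied]) simp
    with step show ?thesis by blast
  qed
qed

lemma family_satisfied_clash_free:
  assumes interp: "is_interp I" and satisfied: "family_satisfied I S"
  shows "family_clash_free S"
  unfolding family_clash_free_def
proof (intro ballI conjI notI)
  fix F
  assume "F \<in> S"
  with satisfied obtain x where x_in: "x \<in> clause_set_ext I F"
    by (auto simp: family_satisfied_def)
  show False if "{||} |\<in>| F"
    using x_in that by (auto simp: in_clause_set_ext_iff)
  show False if "\<exists>L. {|L|} |\<in>| F \<and> {|compl_literal L|} |\<in>| F"
    using that in_clause_set_ext_unit[OF x_in] not_in_literal_ext_compl[OF interp] by blast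
qed

theorem mainTheorem7:
  fixes F :: "('c, 'r) clause_set"
  assumes "satisfiable TYPE('d) F"
  shows "\<exists>S. rule_step\<^sup>*\<^sup>* {F} S \<and> family_complete S \<and> family_clash_free S"
proof -
  from assms obtain I :: "('c, 'r, 'd) interp"
    where interp: "is_interp I" and "clause_set_ext I F \<noteq> {}"
    unfolding satisfiable_def by blast
  define Sat where "Sat = {S. finite S \<and> family_satisfied I S}"
  have "wfp_on Sat rule_step\<inverse>\<inverse>"
    using wfp_on_finite_rule_step by (rule wfp_on_subset) (auto simp: Sat_def)
  moreover have "{F} \<in> Sat"
    using \<open>clause_set_ext I F \<noteq> {}\<close> by (simp add: Sat_def family_satisfied_def)
  ultimately obtain S where in_Sat: "S \<in> Sat" and reachable: "rule_step\<^sup>*\<^sup>* {F} S"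
    and no_step_in_Sat: "\<not> (\<exists>S' \<in> Sat. rule_step S S')"
    using bex_rtransclp_min_element_if_wfp_on[of Sat "rule_step\<inverse>\<inverse>" "{F}"]
    by (auto simp: rtranclp_conversep)
  have "family_complete S"
    using in_Sat no_step_in_Sat satisfied_rule_step_exists[OF interp] rule_step_finite
    unfolding family_complete_def Sat_def by blast
  moreover have "family_clash_free S"
    using in_Sat family_satisfied_clash_free[OF interp] by (simp add: Sat_def)
  ultimately show ?thesis
    using reachable by blast
qed

end
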